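(* Let $m$ be a positive integer. If $C$ is a ternary near-extremal self-dual code of length $12m$, then $A_{3i}(C) \equiv 0 \pmod 8$ for every $i = m, m+1, \ldots, 4m$, where $A_{j}(C)$ denotes the number of codewords of weight $j$ in $C$.
   Context: A ternary code of length $n$ is a linear subspace of $\mathbb{F}_3^n$. Its dual is $C^\perp=\{x\in\mathbb{F}_3^n : \sum_{k=1}^n x_k y_k = 0 \text{ for all } y\in C\}$, and $C$ is self-dual if $C=C^\perp$. The weight of a vector is the number of its nonzero coordinates, and the minimum weight of $C$ is the smallest weight of a nonzero codeword. A ternary self-dual code of length $n$ is called near-extremal if its minimum weight equals $3\lfloor n/12\rfloor$; thus for length $12m$ the minimum weight is $3m$. *)

theory Defs
  imports Main "HOL-Library.Numeral_Type"
begin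

text \<open>Ternary codes. The field F_3 is the type 3 (integers mod 3) from Numeral_Type.
  A vector of length n is a function nat to 3 that vanishes outside the indices 0..n-1.\<close>

definition vecs :: "nat \<Rightarrow> (nat \<Rightarrow> 3) set" where
  "vecs n = {x. \<forall>k\<ge>n. x k = 0}"

definition ternary_code :: "nat \<Rightarrow> (nat \<Rightarrow> 3) set \<Rightarrow> bool" where
  "ternary_code n C \<longleftrightarrow> C \<subseteq> vecs n \<and> (\<lambda>_. 0) \<in> C
     \<and> (\<forall>x\<in>C. \<forall>y\<in>C. (\<lambda>k. x k + y k) \<in> C)
     \<and> (\<forall>a::3. \<forall>x\<in>C. (\<lambda>k. a * x k) \<in> C)"

definition dual_code :: "nat \<Rightarrow> (nat \<Rightarrow> 3) set \<Rightarrow> (nat \<Rightarrow> 3) set" where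
  "dual_code n C = {x \<in> vecs n. \<forall>y\<in>C. (\<Sum>k<n. x k * y k) = 0}"

definition self_dual :: "nat \<Rightarrow> (nat \<Rightarrow> 3) set \<Rightarrow> bool" where
  "self_dual n C \<longleftrightarrow> ternary_code n C \<and> C = dual_code n C"

definition weight :: "nat \<Rightarrow> (nat \<Rightarrow> 3) \<Rightarrow> nat" where
  "weight n x = card {k. k < n \<and> x k \<noteq> 0}"

definition min_weight :: "nat \<Rightarrow> (nat \<Rightarrow> 3) set \<Rightarrow> nat" where
  "min_weight n C = Min {weight n x | x. x \<in> C \<and> x \<noteq> (\<lambda>_. 0)}"

definition near_extremal :: "nat \<Rightarrow> (nat \<Rightarrow> 3) set \<Rightarrow> bool" where
  "near_extremal n C \<longleftrightarrow> self_dual n C \<and> min_weight n C = 3 * (n div 12)"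

definition weight_count :: "nat \<Rightarrow> (nat \<Rightarrow> 3) set \<Rightarrow> nat \<Rightarrow> nat" where
  "weight_count n C j = card {x \<in> C. weight n x = j}"

end

theory Submission
  imports Defs Complex_Main "HOL-Library.FuncSet" "HOL-Computational_Algebra.Polynomial"
begin

text \<open>With \<open>z = y\<^sup>3\<close>, the weight enumerator of a self-dual code of length \<open>12m\<close> is a polynomial of
  degree at most \<open>4m\<close> invariant under the MacWilliams substitution \<open>y \<mapsto> (1 - y)/(1 + 2y)\<close>, which moves
  zeros at \<open>0\<close> to zeros at the cube roots of unity. Hence an invariant polynomial is determined by
  its coefficients up to \<open>z\<^sup>m\<close>, and it is an integral combination of the products
  \<open>(1 + 8z)\<^bsup>3(m-j)\<^esup> (z(1 - z)\<^sup>3)\<^bsup>j\<^esup>\<close>. Modulo \<open>8\<close> the product with \<open>j = 0\<close> is \<open>1\<close>, so the theorem follows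
  once \<open>8\<close> divides the number \<open>A\<close> of words of weight \<open>3m\<close>. The same argument on zeros, applied to the
  difference of the enumerators of words that do not vanish at coordinate \<open>k\<close>, respectively \<open>l\<close>, shows
  that the number \<open>N\<close> of words of weight \<open>3m\<close> not vanishing at a coordinate does not depend on the
  coordinate. So \<open>12m N = 3m A\<close>, that is, \<open>A = 4N\<close>, and \<open>N\<close> is even because \<open>u \<mapsto> -u\<close> acts without fixed
  points.\<close>

section \<open>The MacWilliams identity\<close>

lemma F3_exhaust: "x = 0 \<or> x = 1 \<or> x = 2" for x :: 3
proof (cases x)
  case (of_int z)
  then have "z = 0 \<or> z = 1 \<or> z = 2" by auto
  with of_int show ?thesis by auto
qed

lemma UNIV_F3: "UNIV = {0, 1, 2 :: 3}"
  using F3_exhaust by auto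

lemma sum_F3: "(\<Sum>a\<in>UNIV. f a) = f 0 + f 1 + f (2 :: 3)"
  for f :: "3 \<Rightarrow> 'a :: comm_monoid_add"
  by (subst UNIV_F3) (simp add: add.assoc)

text \<open>The primitive cube root of unity exp(2 pi i/3), given in coordinates so that identities
  reduce to real arithmetic.\<close>

definition omega :: complex where
  "omega = Complex (- 1 / 2) (sqrt 3 / 2)"

lemma omega_sum: "1 + omega + omega\<^sup>2 = 0"
  by (simp add: omega_def complex_eq_iff power2_eq_square)

lemma omega_cube: "omega ^ 3 = 1"
proof -
  have "omega ^ 3 - 1 = (omega - 1) * (1 + omega + omega\<^sup>2)"
    by (simp add: algebra_simps power2_eq_square power3_eq_cube)
  then show ?thesis by (simp add: omega_sum)
qed

text \<open>A nontrivial additive character of F_3.\<close>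

definition chi :: "3 \<Rightarrow> complex" where
  "chi a = (if a = 0 then 1 else if a = 1 then omega else omega\<^sup>2)"

lemma chi_simps [simp]: "chi 0 = 1" "chi 1 = omega" "chi 2 = omega\<^sup>2"
  by (simp_all add: chi_def)

text \<open>Arithmetic on numerals of type \<open>3\<close> can leave 3 or 4 unreduced; this rule
  and the next evaluate \<open>chi\<close> there.\<close>

lemma chi_3 [simp]: "chi 3 = 1"
proof -
  have "(3::3) = 0" by simp
  then show ?thesis by (metis chi_simps(1))
qed

lemma chi_4 [simp]: "chi 4 = omega"
proof -
  have "(4::3) = 1" by simp
  then show ?thesis by (metis chi_simps(2))
qed

lemma chi_add: "chi (a + b) = chi a * chi b"
proof -
  have "omega * omega = omega\<^sup>2" "omega * omega\<^sup>2 = 1" "omega\<^sup>2 * omega = 1" "omega\<^sup>2 * omega\<^sup>2 = omega"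
    using omega_cube by (simp_all add: power2_eq_square power3_eq_cube mult.assoc)
  then show ?thesis
    using F3_exhaust[of a] F3_exhaust[of b] by auto
qed

lemma chi_sum: "chi (sum f A) = (\<Prod>k\<in>A. chi (f k))"
  by (induction A rule: infinite_finite_induct) (simp_all add: chi_add)

lemma chi_neq_1: "a \<noteq> 0 \<Longrightarrow> chi a \<noteq> 1"
  using F3_exhaust[of a] omega_sum
  by (auto simp: omega_def complex_eq_iff power2_eq_square)

lemma finite_vecs: "finite (vecs n)"
proof -
  have "finite {f :: nat \<Rightarrow> 3. \<forall>x. (x \<in> {..<n} \<longrightarrow> f x \<in> UNIV) \<and> (x \<notin> {..<n} \<longrightarrow> f x = 0)}"
    by (rule finite_set_of_finite_funs) auto
  then show ?thesis
    by (rule rev_finite_subset) (auto simp: vecs_def)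
qed

lemma ternary_code_finite: "ternary_code n C \<Longrightarrow> finite C"
  by (auto simp: ternary_code_def intro: finite_subset[OF _ finite_vecs])

text \<open>Distributivity: picking one term from every factor amounts to picking a vector. The
  reindexing only exchanges functions undefined outside the index range for functions that are zero
  there.\<close>

lemma sum_vecs_prod:
  fixes g :: "nat \<Rightarrow> 3 \<Rightarrow> complex"
  shows "(\<Sum>v\<in>vecs n. \<Prod>k<n. g k (v k)) = (\<Prod>k<n. \<Sum>a\<in>UNIV. g k a)"
proof -
  have "(\<Prod>k<n. \<Sum>a\<in>UNIV. g k a) = (\<Sum>f\<in>Pi\<^sub>E {..<n} (\<lambda>_. UNIV). \<Prod>k<n. g k (f k))"
    by (rule prod_sum_PiE) auto
  also have "\<dots> = (\<Sum>v\<in>vecs n. \<Prod>k<n. g k (v k))"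
    by (rule sum.reindex_bij_witness[of _ "\<lambda>v. restrict v {..<n}" "\<lambda>f k. if k < n then f k else 0"])
       (auto simp: vecs_def PiE_def extensional_def fun_eq_iff restrict_def)
  finally show ?thesis by simp
qed

text \<open>Orthogonality of characters: if some codeword \<open>w\<close> has nonzero inner product
  with \<open>v\<close>, translation by \<open>w\<close> multiplies the sum by a factor other than
  1, so the sum is 0.\<close>

lemma ternary_code_sum_chi:
  assumes C: "ternary_code n C" and v: "v \<in> vecs n"
  shows "(\<Sum>u\<in>C. chi (\<Sum>k<n. v k * u k)) = (if v \<in> dual_code n C then of_nat (card C) else 0)"
proof (cases "v \<in> dual_code n C")
  case True
  then show ?thesis by (auto simp: dual_code_def)
next
  case False
  then obtain w where w: "w \<in> C" and ne: "(\<Sum>k<n. v k * w k) \<noteq> 0"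
    using v by (auto simp: dual_code_def)
  have add: "(\<lambda>k. x k + y k) \<in> C" if "x \<in> C" "y \<in> C" for x y
    using C that by (auto simp: ternary_code_def)
  have neg: "(\<lambda>k. 2 * x k) \<in> C" if "x \<in> C" for x
    using C that by (auto simp: ternary_code_def)
  have three: "x + 2 * x = 0" "2 * x + x = 0" for x :: 3
    using F3_exhaust[of x] by auto
  let ?S = "\<Sum>u\<in>C. chi (\<Sum>k<n. v k * u k)"
  \<comment> \<open>Translation by \<open>w\<close> permutes the code; its inverse adds
    \<open>2 * w\<close>, which is \<open>-w\<close> in characteristic 3.\<close>
  have "?S = (\<Sum>u\<in>C. chi (\<Sum>k<n. v k * (u k + w k)))"
    by (rule sum.reindex_bij_witness[of _ "\<lambda>u k. u k + w k" "\<lambda>u k. u k + 2 * w k"])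
       (use add neg w in \<open>auto simp: three add.assoc\<close>)
  also have "\<dots> = ?S * chi (\<Sum>k<n. v k * w k)"
    by (simp add: distrib_left sum.distrib chi_add sum_distrib_right)
  finally have "?S * (chi (\<Sum>k<n. v k * w k) - 1) = 0"
    by (simp add: algebra_simps)
  then show ?thesis
    using chi_neq_1[OF ne] False by simp
qed

text \<open>Each factor on the left is a character sum over F_3; expanding the product and
  exchanging the sums leaves the orthogonality relation. Separate variables at each coordinate make
  it possible to single out words by their support at chosen coordinates.\<close>

lemma macwilliams:
  fixes x y :: "nat \<Rightarrow> complex"
  assumes C: "ternary_code n C"
  shows "(\<Sum>u\<in>C. \<Prod>k<n. if u k = 0 then x k + 2 * y k else x k - y k)
    = of_nat (card C) * (\<Sum>v\<in>dual_code n C. \<Prod>k<n. if v k = 0 then x k else y k)"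
proof -
  let ?g = "\<lambda>v k. if (v k :: 3) = 0 then x k else y k"
  have factor: "(\<Sum>a\<in>UNIV. chi (a * b) * (if a = 0 then x k else y k))
      = (if b = 0 then x k + 2 * y k else x k - y k)" for b k
  proof -
    have "omega + omega\<^sup>2 = - 1"
      using omega_sum by (simp only: add.assoc add_eq_0_iff)
    then have *: "omega * y k + omega\<^sup>2 * y k = - y k" "omega\<^sup>2 * y k + omega * y k = - y k"
      by (simp_all add: add.commute flip: distrib_right)
    consider "b = 0" | "b = 1" | "b = 2" using F3_exhaust by blast
    then show ?thesis
      by cases (simp_all add: sum_F3 * add.assoc)
  qed
  have "(\<Sum>u\<in>C. \<Prod>k<n. if u k = 0 then x k + 2 * y k else x k - y k)
      = (\<Sum>u\<in>C. \<Sum>v\<in>vecs n. \<Prod>k<n. chi (v k * u k) * ?g v k)"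
  proof (intro sum.cong refl)
    fix u
    show "(\<Prod>k<n. if u k = 0 then x k + 2 * y k else x k - y k)
        = (\<Sum>v\<in>vecs n. \<Prod>k<n. chi (v k * u k) * ?g v k)"
      using sum_vecs_prod[where n = n and g = "\<lambda>k a. chi (a * u k) * (if a = 0 then x k else y k)"]
      by (simp only: factor)
  qed
  also have "\<dots> = (\<Sum>v\<in>vecs n. \<Sum>u\<in>C. \<Prod>k<n. chi (v k * u k) * ?g v k)"
    by (rule sum.swap)
  also have "\<dots> = (\<Sum>v\<in>vecs n. (\<Sum>u\<in>C. chi (\<Sum>k<n. v k * u k)) * (\<Prod>k<n. ?g v k))"
    by (simp only: prod.distrib chi_sum sum_distrib_right)
  also have "\<dots> = (\<Sum>v\<in>vecs n. if v \<in> dual_code n C then of_nat (card C) * (\<Prod>k<n. ?g v k) else 0)"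
    by (intro sum.cong refl) (simp add: ternary_code_sum_chi[OF C])
  also have "\<dots> = of_nat (card C) * (\<Sum>v\<in>dual_code n C. \<Prod>k<n. ?g v k)"
    unfolding sum_distrib_left
    by (rule sum.mono_neutral_cong_right[OF finite_vecs]) (auto simp: dual_code_def)
  finally show ?thesis .
qed

section \<open>Size and weights of self-dual codes\<close>

lemma prod_weight:
  fixes a b :: complex
  shows "(\<Prod>k<n. if u k = 0 then a else b) = a ^ (n - weight n u) * b ^ weight n u"
proof -
  have "{..<n} \<inter> {k. u k = 0} = {..<n} - {k. k < n \<and> u k \<noteq> 0}"
       "{..<n} \<inter> - {k. u k = 0} = {k. k < n \<and> u k \<noteq> 0}"
    by auto
  moreover have "card ({..<n} - {k. k < n \<and> u k \<noteq> 0}) = n - weight n u"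
    by (subst card_Diff_subset) (auto simp: weight_def)
  ultimately show ?thesis
    by (simp add: prod.If_cases weight_def)
qed

lemma weight_le: "weight n u \<le> n"
  unfolding weight_def by (rule order.trans[OF card_mono[of "{..<n}"]]) auto

text \<open>The MacWilliams identity at x = y = 1: every word contributes 1 on the dual side, and
  only the zero word survives on the other.\<close>

lemma self_dual_card:
  assumes "self_dual n C"
  shows "card C * card C = 3 ^ n"
proof -
  have C: "ternary_code n C" "dual_code n C = C"
    using assms by (auto simp: self_dual_def)
  have "of_nat (card C) * of_nat (card C)
      = (\<Sum>u\<in>C. \<Prod>k<n. if u k = 0 then 1 + 2 * 1 else 1 - 1 :: complex)"
    by (subst macwilliams[OF C(1)]) (simp add: C(2))
  also have "\<dots> = (\<Sum>u\<in>C. if u = (\<lambda>_. 0) then 3 ^ n else 0)"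
  proof (intro sum.cong refl)
    fix u assume "u \<in> C"
    show "(\<Prod>k<n. if u k = 0 then 1 + 2 * 1 else 1 - 1) = (if u = (\<lambda>_. 0) then 3 ^ n else 0 :: complex)"
    proof (cases "u = (\<lambda>_. 0)")
      case False
      then obtain k where k: "u k \<noteq> 0" by auto
      have "u \<in> vecs n"
        using C(1) \<open>u \<in> C\<close> by (auto simp: ternary_code_def)
      then have "k < n"
        using k unfolding vecs_def mem_Collect_eq by (meson leI)
      then have "(\<Prod>k<n. if u k = 0 then 1 + 2 * 1 else 1 - 1) = (0 :: complex)"
        using k by (intro prod_zero) auto
      then show ?thesis using False by simp
    qed auto
  qed
  also have "\<dots> = 3 ^ n"
    using ternary_code_finite[OF C(1)] C(1) by (simp add: ternary_code_def)
  finally have "of_nat (card C * card C) = (of_nat (3 ^ n) :: complex)" by simp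
  then show ?thesis by (simp only: of_nat_eq_iff)
qed

text \<open>Nonzero squares in F_3 equal 1, so the inner product of \<open>u\<close> with itself is
  its weight modulo 3.\<close>

lemma self_dual_weight_dvd:
  assumes "self_dual n C" "u \<in> C"
  shows "3 dvd weight n u"
proof -
  have "(\<Sum>k<n. u k * u k) = 0"
    using assms by (auto simp: self_dual_def dual_code_def)
  moreover have "u k * u k = (if u k = 0 then 0 else 1)" for k
    using F3_exhaust[of "u k"] by auto
  ultimately have "(\<Sum>k<n. if u k = 0 then 0 else 1 :: 3) = 0"
    by simp
  moreover have "(\<Sum>k<n. if u k = 0 then 0 else 1 :: 3) = of_nat (weight n u)"
  proof -
    have "{..<n} \<inter> - {k. u k = 0} = {k. k < n \<and> u k \<noteq> 0}" by auto
    then show ?thesis by (simp add: sum.If_cases weight_def)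
  qed
  ultimately have "of_nat (weight n u) = (0 :: 3)" by simp
  then show ?thesis by (simp add: of_nat_eq_0_iff_char_dvd)
qed

section \<open>Invariant polynomials\<close>

text \<open>The excluded point is the pole of the MacWilliams substitution; multiplying the
  difference by 1 + 2y makes it vanish there too.\<close>

lemma poly_eqI_away:
  fixes p q :: "complex poly"
  assumes "\<And>y. 1 + 2 * y \<noteq> 0 \<Longrightarrow> poly p y = poly q y"
  shows "p = q"
proof -
  have "poly ([:1, 2:] * (p - q)) y = 0" for y
  proof -
    have "poly ([:1, 2:] * (p - q)) y = (1 + 2 * y) * (poly p y - poly q y)"
      by (simp only: poly_mult poly_diff poly_pCons poly_0 mult_zero_left mult_zero_right add_0_right mult.commute)
    then show ?thesis using assms[of y] by auto
  qed
  then have "[:1, 2:] * (p - q) = 0"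
    by (subst poly_all_0_iff_0[symmetric]) blast
  then have "p - q = 0" by (auto simp only: mult_eq_0_iff pCons_eq_0_iff zero_neq_one one_neq_zero)
  then show ?thesis by simp
qed

lemma sum_order_le_degree_finite:
  fixes p :: "'a :: idom poly"
  assumes "p \<noteq> 0" "finite S"
  shows "(\<Sum>x\<in>S. order x p) \<le> degree p"
proof -
  have "(\<Sum>x\<in>S. order x p) = (\<Sum>x\<in>S \<inter> {x. poly p x = 0}. order x p)"
    using assms by (intro sum.mono_neutral_right) (auto simp: order_root)
  also have "\<dots> \<le> (\<Sum>x | poly p x = 0. order x p)"
    using assms by (intro sum_mono2) (auto simp: poly_roots_finite)
  also have "\<dots> \<le> degree p"
    using assms by (intro sum_order_le_degree)
  finally show ?thesis .
qed

lemma le_order_0I: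
  fixes p :: "'a :: idom poly"
  assumes "p \<noteq> 0" "\<And>j. j < e \<Longrightarrow> coeff p j = 0"
  shows "e \<le> order 0 p"
  using assms by (simp add: monom_1_dvd_iff[symmetric] monom_1_dvd_iff')

lemma pcompose_power: "(p ^ k) \<circ>\<^sub>p q = (p \<circ>\<^sub>p q) ^ k" for p q :: "'a :: comm_semiring_1 poly"
  by (induction k) (simp_all add: pcompose_mult pcompose_1)

text \<open>Cubing is unramified at 1: y^3 - 1 is (y - 1)(1 + y + y^2), and the second factor is 3
  at y = 1. Hence substituting y^3 does not raise the order of the zero at 1.\<close>

lemma le_order_1_cube:
  fixes p :: "complex poly"
  assumes p: "p \<noteq> 0" and dvd: "[:1, -1:] ^ N dvd p \<circ>\<^sub>p monom 1 3"
  shows "N \<le> order 1 p"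
proof (rule ccontr)
  define e where "e = order 1 p"
  obtain q where q: "p = [:-1, 1:] ^ e * q" "\<not> [:-1, 1:] dvd q"
    using order_decomp[OF p, of 1] by (auto simp: e_def)
  assume "\<not> N \<le> order 1 p"
  then have "Suc e \<le> N" by (simp add: e_def)
  have "[:-1, 1::complex:] dvd [:1, -1:]" by (rule dvdI[of _ _ "-1"]) simp
  then have "[:-1, 1::complex:] ^ Suc e dvd [:1, -1:] ^ N"
    by (meson \<open>Suc e \<le> N\<close> dvd_power_same dvd_trans le_imp_power_dvd)
  also note dvd
  also have "p \<circ>\<^sub>p monom 1 3 = [:-1, 1:] ^ e * ([:1, 1, 1:] ^ e * (q \<circ>\<^sub>p monom 1 3))"
  proof -
    have "[:-1, 1:] \<circ>\<^sub>p monom 1 3 = [:-1, 1:] * [:1, 1, 1 :: complex:]"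
      by (simp add: pcompose_pCons monom_altdef eval_nat_numeral one_pCons)
    then show ?thesis
      by (simp only: q(1) pcompose_mult pcompose_power power_mult_distrib mult.assoc)
  qed
  finally have "[:-1, 1:] dvd [:1, 1, 1:] ^ e * (q \<circ>\<^sub>p monom 1 3)"
    by (simp only: power_Suc2 dvd_mult_cancel_left power_eq_0_iff pCons_eq_0_iff) simp
  then have "poly ([:1, 1, 1:] ^ e * (q \<circ>\<^sub>p monom 1 3)) 1 = 0"
    using poly_eq_0_iff_dvd[of _ "1 :: complex"] by blast
  then have "poly q 1 = 0"
    by (simp add: poly_pcompose poly_monom poly_power)
  then show False using q(2) by (simp add: poly_eq_0_iff_dvd)
qed

text \<open>A polynomial \<open>p\<close> of degree at most \<open>d\<close> stands for the binary form
  \<open>x\<^bsup>3d\<^esup> p((y/x)\<^sup>3)\<close>; its MacWilliams transform is the substitution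
  \<open>(x, y) \<mapsto> (x + 2y, x - y)\<close>, followed by setting \<open>x = 1\<close>.\<close>

definition mw :: "nat \<Rightarrow> complex poly \<Rightarrow> complex poly" where
  "mw d p = (\<Sum>j\<le>d. smult (coeff p j) ([:1, -1:] ^ (3 * j) * [:1, 2:] ^ (3 * (d - j))))"

lemma poly_mw:
  assumes "degree p \<le> d" "1 + 2 * y \<noteq> 0"
  shows "poly (mw d p) y = (1 + 2 * y) ^ (3 * d) * poly p (((1 - y) / (1 + 2 * y)) ^ 3)"
proof -
  have *: "(1 - y) ^ (3 * j) * (1 + 2 * y) ^ (3 * (d - j))
      = (1 + 2 * y) ^ (3 * d) * (((1 - y) / (1 + 2 * y)) ^ 3) ^ j" if "j \<le> d" for j
  proof -
    have "(1 + 2 * y) ^ (3 * d) = (1 + 2 * y) ^ (3 * (d - j)) * (1 + 2 * y) ^ (3 * j)"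
      using that by (simp flip: power_add distrib_left)
    then show ?thesis
      using assms(2) by (simp add: power_divide flip: power_mult)
  qed
  have "poly p z = (\<Sum>j\<le>d. coeff p j * z ^ j)" for z
    using assms(1) by (subst poly_altdef, intro sum.mono_neutral_left) (auto simp: coeff_eq_0)
  then show ?thesis
    by (simp add: mw_def poly_sum sum_distrib_left mult.left_commute mult.commute[of y 2] flip: *)
qed

text \<open>The coefficient of index j enters the transform with the factor (1 - y)^(3j), so a zero
  at 0 turns into a zero at y = 1 of three times the order.\<close>

lemma mw_dvd:
  assumes "\<And>j. j < e \<Longrightarrow> coeff p j = 0"
  shows "[:1, -1:] ^ (3 * e) dvd mw d p"
  unfolding mw_def
proof (intro dvd_sum)
  fix j
  show "[:1, -1:] ^ (3 * e) dvd smult (coeff p j) ([:1, -1:] ^ (3 * j) * [:1, 2:] ^ (3 * (d - j)))"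
    using assms[of j] by (cases "j < e") (auto intro!: dvd_smult dvd_mult2 le_imp_power_dvd)
qed

lemma mw_diff: "mw d (p - q) = mw d p - mw d q"
  by (simp add: mw_def smult_diff_left sum_subtractf)

lemma mw_smult: "mw d (smult c p) = smult c (mw d p)"
  using sum_comp_morphism[of "smult c"]
  by (simp add: mw_def o_def smult_add_right flip: smult_smult)

text \<open>The substitution is not divided by sqrt 3, whence the factor 3^(6m), which is also the
  size of a self-dual code of length 12m.\<close>

definition invariant :: "nat \<Rightarrow> complex poly \<Rightarrow> bool" where
  "invariant m p \<longleftrightarrow> degree p \<le> 4 * m \<and> mw (4 * m) p = smult (3 ^ (6 * m)) (p \<circ>\<^sub>p monom 1 3)"

lemma invariantI:
  assumes "degree p \<le> 4 * m"
    and "\<And>y. 1 + 2 * y \<noteq> 0 \<Longrightarrow>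
      (1 + 2 * y) ^ (12 * m) * poly p (((1 - y) / (1 + 2 * y)) ^ 3) = 3 ^ (6 * m) * poly p (y ^ 3)"
  shows "invariant m p"
  unfolding invariant_def
proof (intro conjI assms poly_eqI_away)
  fix y :: complex assume y: "1 + 2 * y \<noteq> 0"
  show "poly (mw (4 * m) p) y = poly (smult (3 ^ (6 * m)) (p \<circ>\<^sub>p monom 1 3)) y"
    using assms(2)[OF y] by (simp add: poly_mw[OF assms(1) y] poly_pcompose poly_monom)
qed

lemma invariant_diff: "invariant m p \<Longrightarrow> invariant m q \<Longrightarrow> invariant m (p - q)"
  by (auto simp: invariant_def mw_diff pcompose_diff smult_diff_right intro: degree_diff_le)

lemma invariant_smult: "invariant m p \<Longrightarrow> invariant m (smult c p)"
  by (auto simp: invariant_def mw_smult pcompose_smult mult.commute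
      intro: order.trans[OF degree_smult_le])

text \<open>A nonzero \<open>p\<close> would have a zero of order at least m + 1 at 0 and, by
  invariance, one of order at least 3(m + 1) at 1, too many for degree at most 4m.\<close>

lemma invariant_eq_0:
  assumes p: "invariant m p" and low: "\<And>j. j \<le> m \<Longrightarrow> coeff p j = 0"
  shows "p = 0"
proof (rule ccontr)
  assume "p \<noteq> 0"
  have "[:1, -1:] ^ (3 * Suc m) dvd mw (4 * m) p"
    by (rule mw_dvd) (simp add: low)
  then have "[:1, -1:] ^ (3 * Suc m) dvd p \<circ>\<^sub>p monom 1 3"
    using p by (simp add: invariant_def dvd_smult_iff)
  then have "3 * Suc m \<le> order 1 p"
    using \<open>p \<noteq> 0\<close> by (rule le_order_1_cube[rotated])
  moreover have "Suc m \<le> order 0 p"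
    using \<open>p \<noteq> 0\<close> low by (intro le_order_0I) auto
  moreover have "(\<Sum>x\<in>{0, 1}. order x p) \<le> degree p"
    using \<open>p \<noteq> 0\<close> by (intro sum_order_le_degree_finite) auto
  moreover have "degree p \<le> 4 * m"
    using p by (simp add: invariant_def)
  ultimately show False by simp
qed

text \<open>The Gleason generators \<open>x\<^sup>4 + 8xy\<^sup>3\<close> and \<open>y\<^sup>3(x\<^sup>3 - y\<^sup>3)\<^sup>3\<close> become
  \<open>1 + 8z\<close> and \<open>z(1 - z)\<^sup>3\<close> with \<open>z = y\<^sup>3\<close>.\<close>

definition gleason :: "nat \<Rightarrow> nat \<Rightarrow> complex poly" where
  "gleason m j = [:1, 8:] ^ (3 * (m - j)) * ([:0, 1:] * [:1, -1:] ^ 3) ^ j"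

text \<open>The substitution multiplies the generators of degrees 4 and 12 by 9 and 9^3, so the
  product acquires 9^(3(m - j)) 9^(3j) = 3^(6m).\<close>

lemma invariant_gleason:
  assumes "j \<le> m"
  shows "invariant m (gleason m j)"
proof (rule invariantI)
  have "degree (gleason m j) \<le> degree ([:1, 8::complex:] ^ (3 * (m - j)))
      + degree (([:0, 1:] * [:1, -1::complex:] ^ 3) ^ j)"
    unfolding gleason_def by (rule degree_mult_le)
  also have "\<dots> = 3 * (m - j) + 4 * j"
    by (simp add: degree_power_eq degree_mult_eq)
  also have "\<dots> \<le> 4 * m" using assms by simp
  finally show "degree (gleason m j) \<le> 4 * m" .
next
  fix y :: complex assume y: "1 + 2 * y \<noteq> 0"
  define t where "t = (1 - y) / (1 + 2 * y)"
  have ty: "(1 + 2 * y) * t = 1 - y" using y by (simp add: t_def)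
  have "(1 + 2 * y) ^ 4 * (1 + 8 * t ^ 3)
      = (1 + 2 * y) ^ 4 + 8 * (1 + 2 * y) * ((1 + 2 * y) * t) ^ 3"
    by (simp add: algebra_simps eval_nat_numeral)
  also have "\<dots> = 9 * (1 + 8 * y ^ 3)"
    unfolding ty by (simp add: algebra_simps eval_nat_numeral)
  finally have g4: "(1 + 2 * y) ^ 4 * (1 + 8 * t ^ 3) = 9 * (1 + 8 * y ^ 3)" .
  have "(1 + 2 * y) ^ 12 * (t ^ 3 * (1 - t ^ 3) ^ 3)
      = ((1 + 2 * y) * t) ^ 3 * ((1 + 2 * y) ^ 3 - ((1 + 2 * y) * t) ^ 3) ^ 3"
  proof -
    have "(1 + 2 * y) ^ 3 - ((1 + 2 * y) * t) ^ 3 = (1 + 2 * y) ^ 3 * (1 - t ^ 3)"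
      by (simp add: power_mult_distrib right_diff_distrib)
    then show ?thesis by (simp add: power_mult_distrib flip: power_mult power_add)
  qed
  also have "\<dots> = (1 - y) ^ 3 * (9 * y * (1 + y + y\<^sup>2)) ^ 3"
  proof -
    have "(1 + 2 * y) ^ 3 - (1 - y) ^ 3 = 9 * y * (1 + y + y\<^sup>2)"
      by (simp add: algebra_simps eval_nat_numeral)
    then show ?thesis unfolding ty by simp
  qed
  also have "\<dots> = 9 ^ 3 * (y ^ 3 * ((1 - y) * (1 + y + y\<^sup>2)) ^ 3)"
    by (simp add: power_mult_distrib)
  also have "(1 - y) * (1 + y + y\<^sup>2) = 1 - y ^ 3"
    by (simp add: algebra_simps eval_nat_numeral)
  finally have g12: "(1 + 2 * y) ^ 12 * (t ^ 3 * (1 - t ^ 3) ^ 3) = 9 ^ 3 * (y ^ 3 * (1 - y ^ 3) ^ 3)" .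
  have eval: "poly (gleason m j) z = (1 + 8 * z) ^ (3 * (m - j)) * (z * (1 - z) ^ 3) ^ j" for z
    by (simp add: gleason_def mult.commute)
  have "(1 + 2 * y) ^ (12 * m) = ((1 + 2 * y) ^ 4) ^ (3 * (m - j)) * ((1 + 2 * y) ^ 12) ^ j"
    using assms by (simp add: algebra_simps flip: power_mult power_add)
  then have "(1 + 2 * y) ^ (12 * m) * poly (gleason m j) (t ^ 3)
      = ((1 + 2 * y) ^ 4 * (1 + 8 * t ^ 3)) ^ (3 * (m - j))
        * ((1 + 2 * y) ^ 12 * (t ^ 3 * (1 - t ^ 3) ^ 3)) ^ j"
    by (simp only: eval power_mult_distrib mult_ac)
  also have "\<dots> = (9 ^ (3 * (m - j)) * (9 ^ 3) ^ j) * poly (gleason m j) (y ^ 3)"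
    unfolding g4 g12 by (simp only: eval power_mult_distrib mult_ac)
  also have "9 ^ (3 * (m - j)) * (9 ^ 3) ^ j = (9 :: complex) ^ (3 * m)"
  proof -
    have "3 * (m - j) + 3 * j = 3 * m" using assms by simp
    then show ?thesis by (simp only: power_mult[symmetric] power_add[symmetric])
  qed
  also have "\<dots> = (3 ^ 2) ^ (3 * m)" by simp
  also have "\<dots> = 3 ^ (6 * m)" by (subst power_mult[symmetric]) simp
  finally show "(1 + 2 * y) ^ (12 * m) * poly (gleason m j) (((1 - y) / (1 + 2 * y)) ^ 3)
      = 3 ^ (6 * m) * poly (gleason m j) (y ^ 3)"
    unfolding t_def .
qed

section \<open>Integrality and triangularity of the generators\<close>

lemma coeff_mult_Ints:
  fixes p q :: "'a :: comm_ring_1 poly"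
  assumes "\<And>i. coeff p i \<in> \<int>" "\<And>i. coeff q i \<in> \<int>"
  shows "coeff (p * q) i \<in> \<int>"
  unfolding coeff_mult by (intro Ints_sum Ints_mult assms)

lemma coeff_power_Ints:
  fixes p :: "'a :: comm_ring_1 poly"
  assumes "\<And>i. coeff p i \<in> \<int>"
  shows "coeff (p ^ k) i \<in> \<int>"
proof (induction k arbitrary: i)
  case (Suc k)
  then show ?case by (auto intro!: coeff_mult_Ints assms)
qed (auto simp: coeff_1)

lemma coeff_gleason_Ints: "coeff (gleason m j) i \<in> \<int>"
  unfolding gleason_def
  by (intro coeff_mult_Ints coeff_power_Ints) (auto simp: coeff_pCons split: nat.split)

text \<open>Splitting off z^j leaves a cofactor with constant term 1, from which unitriangularity is
  read off.\<close>

lemma gleason_eq_monom_mult: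
  "gleason m j = monom 1 j * ([:1, 8:] ^ (3 * (m - j)) * [:1, -1:] ^ (3 * j))"
proof -
  have "monom 1 j = [:0, 1 :: complex:] ^ j" by (simp add: monom_altdef)
  then show ?thesis
    by (simp only: gleason_def power_mult_distrib mult_ac power_mult[symmetric])
qed

lemma coeff_gleason_less: "i < j \<Longrightarrow> coeff (gleason m j) i = 0"
  by (simp add: gleason_eq_monom_mult coeff_monom_mult)

lemma coeff_gleason_eq: "coeff (gleason m j) j = 1"
  by (simp add: gleason_eq_monom_mult coeff_monom_mult flip: poly_0_coeff_0)

text \<open>For j = 0 the product is (1 + 8z)^(3m), congruent to 1 modulo 8. As coefficients are
  complex numbers, the congruence is expressed by integrality of a quotient.\<close>

lemma coeff_gleason_0_mod_8: "(coeff (gleason m 0) i - coeff 1 i) / 8 \<in> \<int>"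
proof -
  have "\<exists>q. (\<forall>i. coeff q i \<in> \<int>) \<and> [:1, 8::complex:] ^ k = 1 + smult 8 q" for k
  proof (induction k)
    case (Suc k)
    then obtain q where q: "\<forall>i. coeff q i \<in> \<int>" "[:1, 8::complex:] ^ k = 1 + smult 8 q" by blast
    have "[:1, 8::complex:] ^ Suc k = 1 + smult 8 (q + [:0, 1:] * [:1, 8:] ^ k)"
    proof -
      have "[:1, 8:] = 1 + smult 8 [:0, 1 :: complex:]" by (simp add: one_pCons)
      then have "[:1, 8:] * r = r + smult 8 ([:0, 1 :: complex:] * r)" for r
        by (simp only: distrib_right mult_1_left mult_smult_left)
      from this[of "[:1, 8:] ^ k"] show ?thesis
        by (simp only: power_Suc smult_add_right add.assoc[symmetric]) (simp only: q(2))
    qed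
    moreover have "coeff (q + [:0, 1:] * [:1, 8:] ^ k) i \<in> \<int>" for i
      unfolding coeff_add using q(1)
      by (intro Ints_add coeff_mult_Ints coeff_power_Ints)
         (auto simp: coeff_pCons split: nat.split)
    ultimately show ?case by blast
  qed (auto intro: exI[of _ 0])
  from this[of "3 * m"] obtain q where
    "\<forall>i. coeff q i \<in> \<int>" "gleason m 0 = 1 + smult 8 q"
    by (auto simp: gleason_def)
  then show ?thesis by simp
qed

text \<open>Because the generators have unitriangular integral coefficients, an invariant polynomial is
  an integral combination of them as soon as its coefficients up to \<open>m\<close> are integral.\<close>

lemma invariant_coeff_Ints:
  assumes "invariant m p" "\<And>i. i \<le> m \<Longrightarrow> coeff p i \<in> \<int>"
  shows "coeff p i \<in> \<int>"
proof -
  \<comment> \<open>Here \<open>k\<close> bounds the initial run of vanishing coefficients; the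
    induction descends from m + 1, where \<open>p\<close> is 0 by uniqueness.\<close>
  have "coeff p i \<in> \<int>"
    if "k \<le> Suc m" "invariant m p" "\<And>i. i \<le> m \<Longrightarrow> coeff p i \<in> \<int>" "\<And>i. i < k \<Longrightarrow> coeff p i = 0"
    for k p i
    using that
  proof (induction k arbitrary: p i rule: inc_induct)
    case base
    then have "p = 0" by (intro invariant_eq_0) auto
    then show ?case by simp
  next
    case (step k)
    have int: "coeff p k \<in> \<int>" using step.hyps step.prems by auto
    \<comment> \<open>Unitriangularity makes this subtraction clear coefficient \<open>k\<close>
      without disturbing the zeros below it.\<close>
    define q where "q = p - smult (coeff p k) (gleason m k)"
    have "coeff q i \<in> \<int>"
    proof (rule step.IH)
      show "invariant m q"
        unfolding q_def using step by (intro invariant_diff invariant_smult invariant_gleason) auto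
      show "coeff q i \<in> \<int>" if "i \<le> m" for i
        unfolding q_def coeff_diff coeff_smult
        by (intro Ints_diff Ints_mult int coeff_gleason_Ints step.prems that)
      show "coeff q i = 0" if "i < Suc k" for i
        using that step.prems
        by (cases "i = k") (auto simp: q_def coeff_gleason_less coeff_gleason_eq)
    qed
    moreover have "coeff p i = coeff q i + coeff p k * coeff (gleason m k) i"
      by (simp add: q_def)
    ultimately show ?case
      using int by (metis Ints_add Ints_mult coeff_gleason_Ints)
  qed
  from this[of 0 p i] show ?thesis using assms by simp
qed

section \<open>Weight enumerators\<close>

text \<open>For a self-dual code all weights are multiples of 3, so this is the weight enumerator in
  z = y^3, with each word \<open>u\<close> counted with multiplicity \<open>f u\<close>.\<close>

definition wpoly :: "nat \<Rightarrow> (nat \<Rightarrow> 3) set \<Rightarrow> ((nat \<Rightarrow> 3) \<Rightarrow> complex) \<Rightarrow> complex poly" where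
  "wpoly n C f = (\<Sum>u\<in>C. monom (f u) (weight n u div 3))"

lemma self_dual_finite: "self_dual n C \<Longrightarrow> finite C"
  by (auto simp: self_dual_def intro: ternary_code_finite)

lemma coeff_wpoly:
  assumes "self_dual n C"
  shows "coeff (wpoly n C f) i = (\<Sum>u | u \<in> C \<and> weight n u = 3 * i. f u)"
proof -
  have "coeff (wpoly n C f) i = (\<Sum>u\<in>C. if weight n u div 3 = i then f u else 0)"
    by (simp add: wpoly_def coeff_sum coeff_monom)
  also have "\<dots> = (\<Sum>u\<in>C. if weight n u = 3 * i then f u else 0)"
    using self_dual_weight_dvd[OF assms] by (intro sum.cong refl if_cong) auto
  finally show ?thesis
    by (simp add: sum.inter_filter self_dual_finite[OF assms])
qed

lemma degree_wpoly_le: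
  assumes "\<And>u. u \<in> C \<Longrightarrow> f u \<noteq> 0 \<Longrightarrow> weight n u div 3 \<le> d"
  shows "degree (wpoly n C f) \<le> d"
proof (rule degree_le, intro allI impI)
  fix i assume "d < i"
  then have "\<forall>u\<in>C. coeff (monom (f u) (weight n u div 3)) i = 0"
    using assms by (force simp: coeff_monom)
  then show "coeff (wpoly n C f) i = 0"
    by (simp add: wpoly_def coeff_sum)
qed

lemma poly_wpoly_cube:
  assumes "self_dual n C"
  shows "poly (wpoly n C f) (y ^ 3) = (\<Sum>u\<in>C. f u * y ^ weight n u)"
  using self_dual_weight_dvd[OF assms]
  by (auto simp: wpoly_def poly_sum poly_monom simp flip: power_mult intro!: sum.cong)

lemma poly_wpoly_transform:
  assumes "self_dual n C" "1 + 2 * y \<noteq> 0"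
  shows "(1 + 2 * y) ^ n * poly (wpoly n C f) (((1 - y) / (1 + 2 * y)) ^ 3)
    = (\<Sum>u\<in>C. f u * ((1 + 2 * y) ^ (n - weight n u) * (1 - y) ^ weight n u))"
proof -
  have "(1 + 2 * y) ^ n * ((1 - y) / (1 + 2 * y)) ^ w = (1 + 2 * y) ^ (n - w) * (1 - y) ^ w"
    if "w \<le> n" for w
  proof -
    have "(1 + 2 * y) ^ n = (1 + 2 * y) ^ (n - w) * (1 + 2 * y) ^ w"
      using that by (simp flip: power_add)
    then show ?thesis using assms(2) by (simp add: power_divide)
  qed
  then show ?thesis
    using assms(1) by (simp add: poly_wpoly_cube sum_distrib_left mult.left_commute weight_le)
qed

text \<open>This is the MacWilliams identity with x = 1 and a common y, divided by no power of 3
  because the code has 3^(6m) words.\<close>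

lemma invariant_weight_enumerator:
  assumes C: "self_dual (12 * m) C"
  shows "invariant m (wpoly (12 * m) C (\<lambda>_. 1))"
proof (rule invariantI)
  show "degree (wpoly (12 * m) C (\<lambda>_. 1)) \<le> 4 * m"
  proof (rule degree_wpoly_le)
    show "weight (12 * m) u div 3 \<le> 4 * m" for u
      using weight_le[of "12 * m" u] by linarith
  qed
next
  fix y :: complex assume y: "1 + 2 * y \<noteq> 0"
  have "card C * card C = (3 ^ (6 * m)) * 3 ^ (6 * m)"
    using self_dual_card[OF C] by (simp flip: power_add)
  then have card: "card C = 3 ^ (6 * m)"
    by (metis power2_eq_square power2_eq_iff_nonneg zero_le)
  have "(\<Sum>u\<in>C. (1 + 2 * y) ^ (12 * m - weight (12 * m) u) * (1 - y) ^ weight (12 * m) u)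
      = of_nat (card C) * (\<Sum>v\<in>C. y ^ weight (12 * m) v)"
    using C macwilliams[of "12 * m" C "\<lambda>_. 1" "\<lambda>_. y"]
    by (simp add: self_dual_def prod_weight)
  then show "(1 + 2 * y) ^ (12 * m) * poly (wpoly (12 * m) C (\<lambda>_. 1)) (((1 - y) / (1 + 2 * y)) ^ 3)
      = 3 ^ (6 * m) * poly (wpoly (12 * m) C (\<lambda>_. 1)) (y ^ 3)"
    by (subst poly_wpoly_transform[OF C y], subst poly_wpoly_cube[OF C]) (simp add: card)
qed

section \<open>Words of minimum weight form a 1-design\<close>

definition coord_diff :: "nat \<Rightarrow> nat \<Rightarrow> (nat \<Rightarrow> 3) \<Rightarrow> complex" where
  "coord_diff k l u = of_bool (u k \<noteq> 0) - of_bool (u l \<noteq> 0)"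

text \<open>Setting x = 0 at \<open>k\<close> and y = 0 at \<open>l\<close> selects the words that
  are nonzero at \<open>k\<close> and zero at \<open>l\<close>. After the transform the factor at
  \<open>l\<close> is always 1, and the one at \<open>k\<close> is 2y or -y.\<close>

lemma macwilliams_pair:
  fixes y :: complex
  assumes C: "self_dual n C" and kl: "k < n" "l < n" "k \<noteq> l"
  shows "of_nat (card C) * (\<Sum>v\<in>C. of_bool (v k \<noteq> 0 \<and> v l = 0) * y ^ weight n v)
    = (\<Sum>u\<in>C. (if u k = 0 then 2 * y else - y) *
        (\<Prod>i\<in>{..<n} - {k, l}. if u i = 0 then 1 + 2 * y else 1 - y))"
proof -
  define X where "X i = (if i = k then 0 else 1 :: complex)" for i
  define Y where "Y i = (if i = l then 0 else y)" for i
  have "(\<Prod>i<n. if v i = 0 then X i else Y i) = of_bool (v k \<noteq> 0 \<and> v l = 0) * y ^ weight n v"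
    for v :: "nat \<Rightarrow> 3"
  proof (cases "v k \<noteq> 0 \<and> v l = 0")
    case True
    then have "(\<Prod>i<n. if v i = 0 then X i else Y i) = (\<Prod>i<n. if v i = 0 then 1 else y)"
      by (intro prod.cong refl) (auto simp: X_def Y_def)
    then show ?thesis using True by (simp add: prod_weight)
  next
    case False
    then have "\<exists>i\<in>{..<n}. (if v i = 0 then X i else Y i) = 0"
      using kl by (auto simp: X_def Y_def)
    then have zero: "(\<Prod>i<n. if v i = 0 then X i else Y i) = 0"
      by (intro prod_zero) auto
    show ?thesis unfolding zero using False by simp
  qed
  moreover have "(\<Prod>i<n. if u i = 0 then X i + 2 * Y i else X i - Y i)
      = (if u k = 0 then 2 * y else - y) * (\<Prod>i\<in>{..<n} - {k, l}. if u i = 0 then 1 + 2 * y else 1 - y)"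
    for u :: "nat \<Rightarrow> 3"
  proof -
    have "{..<n} - {k, l} = {..<n} - {k} - {l}" by auto
    moreover have "(\<Prod>i\<in>{..<n} - {k, l}. if u i = 0 then X i + 2 * Y i else X i - Y i)
        = (\<Prod>i\<in>{..<n} - {k, l}. if u i = 0 then 1 + 2 * y else 1 - y)"
      by (intro prod.cong refl) (auto simp: X_def Y_def)
    ultimately show ?thesis
      using kl prod.remove[of "{..<n}" k "\<lambda>i. if u i = 0 then X i + 2 * Y i else X i - Y i"]
        prod.remove[of "{..<n} - {k}" l "\<lambda>i. if u i = 0 then X i + 2 * Y i else X i - Y i"]
      by (simp add: X_def Y_def)
  qed
  ultimately show ?thesis
    using C macwilliams[of n C X Y] by (simp add: self_dual_def)
qed

text \<open>Subtract from the pair identity the one with \<open>k\<close> and \<open>l\<close>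
  exchanged; 2y - (-y) = 3y yields the constant, and the omitted factors at \<open>k\<close> and
  \<open>l\<close> are then restored.\<close>

lemma macwilliams_coord_diff:
  fixes y :: complex
  assumes C: "self_dual n C" and kl: "k < n" "l < n" "k \<noteq> l"
  shows "of_nat (card C) * ((1 + 2 * y) * (1 - y)) * (\<Sum>v\<in>C. coord_diff k l v * y ^ weight n v)
    = - 3 * y * (\<Sum>u\<in>C. coord_diff k l u * ((1 + 2 * y) ^ (n - weight n u) * (1 - y) ^ weight n u))"
proof -
  let ?R = "\<lambda>u. \<Prod>i\<in>{..<n} - {k, l}. if u i = (0 :: 3) then 1 + 2 * y else 1 - y"
  have "{l, k} = {k, l}" by auto
  then have "of_nat (card C) * (\<Sum>v\<in>C. of_bool (v k \<noteq> 0 \<and> v l = 0) * y ^ weight n v)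
      - of_nat (card C) * (\<Sum>v\<in>C. of_bool (v l \<noteq> 0 \<and> v k = 0) * y ^ weight n v)
      = (\<Sum>u\<in>C. (if u k = 0 then 2 * y else - y) * ?R u)
      - (\<Sum>u\<in>C. (if u l = 0 then 2 * y else - y) * ?R u)"
    using macwilliams_pair[OF C kl, of y] macwilliams_pair[OF C kl(2,1), of y] kl(3) by simp
  also have "of_nat (card C) * (\<Sum>v\<in>C. of_bool (v k \<noteq> 0 \<and> v l = 0) * y ^ weight n v)
      - of_nat (card C) * (\<Sum>v\<in>C. of_bool (v l \<noteq> 0 \<and> v k = 0) * y ^ weight n v)
      = of_nat (card C) * (\<Sum>v\<in>C. coord_diff k l v * y ^ weight n v)"
    unfolding right_diff_distrib[symmetric] sum_subtractf[symmetric]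
    by (intro arg_cong2[of _ _ _ _ "(*)"] sum.cong refl) (auto simp: coord_diff_def)
  also have "(\<Sum>u\<in>C. (if u k = 0 then 2 * y else - y) * ?R u)
      - (\<Sum>u\<in>C. (if u l = 0 then 2 * y else - y) * ?R u)
      = (\<Sum>u\<in>C. - 3 * y * (coord_diff k l u * ?R u))"
    unfolding sum_subtractf[symmetric]
    by (intro sum.cong refl) (auto simp: coord_diff_def algebra_simps)
  finally have eq: "of_nat (card C) * (\<Sum>v\<in>C. coord_diff k l v * y ^ weight n v)
      = (\<Sum>u\<in>C. - 3 * y * (coord_diff k l u * ?R u))" .
  \<comment> \<open>Where \<open>coord_diff\<close> is nonzero, exactly one of the two coordinates
    vanishes, so the missing factors are 1 + 2y and 1 - y.\<close>
  have factor: "coord_diff k l u * (((1 + 2 * y) * (1 - y)) * ?R u)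
      = coord_diff k l u * ((1 + 2 * y) ^ (n - weight n u) * (1 - y) ^ weight n u)" for u
  proof -
    have "{..<n} - {k, l} = {..<n} - {k} - {l}" by auto
    then have "(\<Prod>i<n. if u i = 0 then 1 + 2 * y else 1 - y)
        = (if u k = 0 then 1 + 2 * y else 1 - y) * (if u l = 0 then 1 + 2 * y else 1 - y) * ?R u"
      using kl prod.remove[of "{..<n}" k "\<lambda>i. if u i = 0 then 1 + 2 * y else 1 - y"]
        prod.remove[of "{..<n} - {k}" l "\<lambda>i. if u i = 0 then 1 + 2 * y else 1 - y"]
      by (simp only: finite_lessThan finite_Diff lessThan_iff Diff_iff singleton_iff not_sym mult.assoc) auto
    then show ?thesis
      unfolding prod_weight by (auto simp: coord_diff_def mult.commute)
  qed
  have "of_nat (card C) * ((1 + 2 * y) * (1 - y)) * (\<Sum>v\<in>C. coord_diff k l v * y ^ weight n v)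
      = ((1 + 2 * y) * (1 - y)) * (of_nat (card C) * (\<Sum>v\<in>C. coord_diff k l v * y ^ weight n v))"
    by (simp only: mult_ac)
  also have "\<dots> = ((1 + 2 * y) * (1 - y)) * (\<Sum>u\<in>C. - 3 * y * (coord_diff k l u * ?R u))"
    unfolding eq ..
  also have "\<dots> = - 3 * y * (\<Sum>u\<in>C. coord_diff k l u * (((1 + 2 * y) * (1 - y)) * ?R u))"
    unfolding sum_distrib_left by (intro sum.cong refl) (simp only: mult_ac)
  finally show ?thesis by (simp only: factor)
qed

lemma near_extremal_min_weight:
  assumes "near_extremal (12 * m) C" "u \<in> C" "u \<noteq> (\<lambda>_. 0)"
  shows "3 * m \<le> weight (12 * m) u"
proof -
  have "finite C"
    using assms(1) by (auto simp: near_extremal_def intro: self_dual_finite)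
  then have "finite {weight (12 * m) x | x. x \<in> C \<and> x \<noteq> (\<lambda>_. 0)}" by simp
  then have "min_weight (12 * m) C \<le> weight (12 * m) u"
    unfolding min_weight_def using assms by (intro Min_le) auto
  then show ?thesis using assms(1) by (simp add: near_extremal_def)
qed

text \<open>The polynomial has degree less than \<open>4m\<close>, but zeros of order \<open>m\<close> at \<open>0\<close> and \<open>3m - 1\<close> at \<open>1\<close>, and
  one more at \<open>-1/8\<close>, the value of \<open>y\<^sup>3\<close> at the pole \<open>y = -1/2\<close> of the substitution.\<close>

lemma coord_diff_wpoly_eq_0:
  assumes m: "m > 0" and ne: "near_extremal (12 * m) C"
    and kl: "k < 12 * m" "l < 12 * m" "k \<noteq> l"
  shows "wpoly (12 * m) C (coord_diff k l) = 0"
proof (rule ccontr)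
  define n where "n = 12 * m"
  define p where "p = wpoly n C (coord_diff k l)"
  define K :: complex where "K = of_nat (card C)"
  assume "wpoly (12 * m) C (coord_diff k l) \<noteq> 0"
  then have "p \<noteq> 0" by (simp add: p_def n_def)
  have C: "self_dual n C" using ne by (simp add: near_extremal_def n_def)
  have kl_n: "k < n" "l < n" using kl by (simp_all add: n_def)
  have "card C \<noteq> 0" using self_dual_card[OF C] by (metis mult_0 power_not_zero zero_neq_numeral)
  then have "K \<noteq> 0" unfolding K_def of_nat_eq_0_iff .
  \<comment> \<open>Words of full weight are nonzero at both coordinates and cancel, which lowers
    the bound by one.\<close>
  have deg: "degree p \<le> 4 * m - 1"
    unfolding p_def
  proof (rule degree_wpoly_le)
    fix u assume "coord_diff k l u \<noteq> 0"
    then have "u k = 0 \<or> u l = 0" by (auto simp: coord_diff_def)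
    then have "{i. i < n \<and> u i \<noteq> 0} \<subset> {..<n}"
      using kl by (auto simp: n_def)
    then have "card {i. i < n \<and> u i \<noteq> 0} < card {..<n}"
      by (intro psubset_card_mono) simp_all
    then have "weight n u < n" by (simp add: weight_def)
    then show "weight n u div 3 \<le> 4 * m - 1"
      unfolding n_def by linarith
  qed
  \<comment> \<open>The zero word, the only word of weight below 3m, also has
    \<open>coord_diff\<close> 0.\<close>
  have low: "coeff p j = 0" if "j < m" for j
  proof -
    have "coord_diff k l u = 0" if "u \<in> C" "weight n u = 3 * j" for u
      using near_extremal_min_weight[OF ne \<open>u \<in> C\<close>] that \<open>j < m\<close>
      by (cases "u = (\<lambda>_. 0)") (auto simp: n_def coord_diff_def)
    then show ?thesis by (simp add: p_def coeff_wpoly[OF C])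
  qed
  \<comment> \<open>Since 12m = 3(4m - 1) + 3, the lower degree bound frees a factor (1 + 2y)^3, one
    power of which cancels.\<close>
  have eq: "smult K ([:1, -1:] * (p \<circ>\<^sub>p monom 1 3)) = [:0, -3:] * [:1, 2:] ^ 2 * mw (4 * m - 1) p"
  proof (rule poly_eqI_away)
    fix y :: complex assume y: "1 + 2 * y \<noteq> 0"
    have "12 * m = 3 * (4 * m - 1) + 3" using m by simp
    then have "(1 + 2 * y) ^ n = (1 + 2 * y) ^ 3 * (1 + 2 * y) ^ (3 * (4 * m - 1))"
      unfolding n_def by (metis power_add mult.commute)
    then have transform: "(1 + 2 * y) ^ n * poly p (((1 - y) / (1 + 2 * y)) ^ 3)
        = (1 + 2 * y) ^ 3 * poly (mw (4 * m - 1) p) y"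
      by (simp only: poly_mw[OF deg y] mult.assoc)
    have "K * ((1 + 2 * y) * (1 - y)) * poly p (y ^ 3) = - 3 * y * ((1 + 2 * y) ^ 3 * poly (mw (4 * m - 1) p) y)"
      using macwilliams_coord_diff[OF C kl_n kl(3), of y]
      by (simp only: flip: transform, simp only: p_def K_def poly_wpoly_transform[OF C y],
          simp only: poly_wpoly_cube[OF C])
    then have "(1 + 2 * y) * (K * ((1 - y) * poly p (y ^ 3)))
        = (1 + 2 * y) * (- 3 * y * (1 + 2 * y) ^ 2 * poly (mw (4 * m - 1) p) y)"
      by (simp only: power3_eq_cube power2_eq_square mult_ac)
    then have "K * ((1 - y) * poly p (y ^ 3)) = - 3 * y * (1 + 2 * y) ^ 2 * poly (mw (4 * m - 1) p) y"
      using y by (simp only: mult_cancel_left) simp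
    then show "poly (smult K ([:1, -1:] * (p \<circ>\<^sub>p monom 1 3))) y
        = poly ([:0, -3:] * [:1, 2:] ^ 2 * mw (4 * m - 1) p) y"
      by (simp only: poly_smult poly_mult poly_pcompose poly_monom poly_power poly_pCons poly_0) (simp add: mult_ac)
  qed
  have "[:1, -1:] ^ (3 * m) dvd [:0, -3:] * [:1, 2:] ^ 2 * mw (4 * m - 1) p"
    by (intro dvd_mult mw_dvd low)
  then have "[:1, -1:] ^ (3 * m) dvd [:1, -1:] * (p \<circ>\<^sub>p monom 1 3)"
    unfolding eq[symmetric] using \<open>K \<noteq> 0\<close> by (rule dvd_smult_cancel)
  \<comment> \<open>One of the 3m factors is absorbed by the explicit 1 - y in
    \<open>eq\<close>.\<close>
  moreover have "[:1, -1:] ^ (3 * m) = [:1, -1:] * [:1, -1 :: complex:] ^ (3 * m - 1)"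
    using m by (simp only: power_Suc[symmetric]) simp
  ultimately have "[:1, -1:] ^ (3 * m - 1) dvd p \<circ>\<^sub>p monom 1 3"
    by (simp only: dvd_mult_cancel_left) simp
  then have "3 * m - 1 \<le> order 1 p"
    by (rule le_order_1_cube[OF \<open>p \<noteq> 0\<close>])
  moreover have "m \<le> order 0 p"
    by (rule le_order_0I[OF \<open>p \<noteq> 0\<close> low])
  \<comment> \<open>The square left in \<open>eq\<close> vanishes at y = -1/2, where 1 - y does
    not.\<close>
  moreover have "poly p (- 1 / 8) = 0"
  proof -
    have "poly (smult K ([:1, -1:] * (p \<circ>\<^sub>p monom 1 3))) (- 1 / 2) = 0"
      unfolding eq by (simp add: poly_power)
    moreover have "(- 1 / 2 :: complex) ^ 3 = - 1 / 8" by (simp add: power3_eq_cube)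
    ultimately show ?thesis
      using \<open>K \<noteq> 0\<close> by (simp only: poly_smult poly_mult poly_pcompose poly_monom) simp
  qed
  then have "1 \<le> order (- 1 / 8) p"
    using \<open>p \<noteq> 0\<close> by (simp add: order_root)
  \<comment> \<open>The three orders add up to at least m + (3m - 1) + 1 = 4m, above the degree
    bound 4m - 1.\<close>
  moreover have "(\<Sum>x\<in>{0, 1, - 1 / 8}. order x p) \<le> degree p"
    using \<open>p \<noteq> 0\<close> by (intro sum_order_le_degree_finite) auto
  moreover have "(1 :: complex) \<noteq> - 1 / 8" by (simp add: complex_eq_iff)
  ultimately show False
    using deg m by simp
qed

lemma min_weight_count_mod_8:
  assumes m: "m > 0" and ne: "near_extremal (12 * m) C"
  shows "8 dvd weight_count (12 * m) C (3 * m)"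
proof -
  define S where "S = {u \<in> C. weight (12 * m) u = 3 * m}"
  define N where "N k = card {u \<in> S. u k \<noteq> 0}" for k
  have C: "self_dual (12 * m) C" using ne by (simp add: near_extremal_def)
  have "finite S" using self_dual_finite[OF C] by (simp add: S_def)
  have N: "N k = (\<Sum>u\<in>S. of_bool (u k \<noteq> 0))" for k
  proof -
    have "{u \<in> S. u k \<noteq> 0} = S \<inter> {u. u k \<noteq> 0}" by auto
    then show ?thesis using \<open>finite S\<close> by (simp add: N_def)
  qed
  have N_eq: "N k = N 0" if "k < 12 * m" for k
  proof (cases "k = 0")
    case False
    \<comment> \<open>This sum is \<open>N k - N 0\<close>, and it is also the coefficient of z^m in
      a polynomial known to vanish.\<close>
    have "(\<Sum>u\<in>S. coord_diff k 0 u) = coeff (wpoly (12 * m) C (coord_diff k 0)) m"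
      by (simp add: coeff_wpoly[OF C] S_def)
    also have "\<dots> = 0"
      using coord_diff_wpoly_eq_0[OF m ne that, of 0] False m by simp
    finally have "of_nat (N k) = (of_nat (N 0) :: complex)"
      by (simp add: N coord_diff_def sum_subtractf of_nat_sum)
    then show ?thesis by simp
  qed simp
  \<comment> \<open>Double counting of the pairs of a word in \<open>S\<close> and a coordinate in
    its support.\<close>
  have "(\<Sum>k<12 * m. N 0) = (\<Sum>k<12 * m. N k)"
    by (intro sum.cong refl N_eq[symmetric]) simp
  also have "\<dots> = (\<Sum>u\<in>S. \<Sum>k<12 * m. of_bool (u k \<noteq> 0))"
    unfolding N by (rule sum.swap)
  also have "\<dots> = (\<Sum>u\<in>S. weight (12 * m) u)"
  proof (intro sum.cong refl)
    fix u :: "nat \<Rightarrow> 3"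
    have "{k. k < 12 * m \<and> u k \<noteq> 0} = {..<12 * m} \<inter> {k. u k \<noteq> 0}" by auto
    then show "(\<Sum>k<12 * m. of_bool (u k \<noteq> 0)) = weight (12 * m) u"
      by (simp add: weight_def)
  qed
  also have "\<dots> = 3 * m * card S" by (simp add: S_def)
  finally have "12 * m * N 0 = 3 * m * card S" by simp
  then have "card S = 4 * N 0" using m by simp
  \<comment> \<open>Negation preserves \<open>S\<close> and exchanges the values 1 and 2 at
    coordinate 0.\<close>
  moreover have "N 0 = 2 * card {u \<in> S. u 0 = 1}"
  proof -
    have neg: "(\<lambda>k. - u k) \<in> S" if "u \<in> S" for u
    proof -
      have "2 * x + x = 0" for x :: 3 using F3_exhaust[of x] by auto
      then have two: "2 * x = - x" for x :: 3 by (simp only: eq_neg_iff_add_eq_0)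
      have "(\<lambda>k. 2 * u k) \<in> C"
        using that C by (auto simp: S_def self_dual_def ternary_code_def)
      then have "(\<lambda>k. - u k) \<in> C" by (simp only: two)
      then show ?thesis using that by (simp add: S_def weight_def)
    qed
    have "(2::3) + 1 = 0" by simp
    then have two: "(2::3) = - 1" by (simp only: eq_neg_iff_add_eq_0)
    have "bij_betw (\<lambda>u k. - u k) {u \<in> S. u 0 = 1} {u \<in> S. u 0 = 2}"
      unfolding two by (rule bij_betwI[where g = "\<lambda>u k. - u k"]) (auto intro: neg)
    then have "card {u \<in> S. u 0 = 1} = card {u \<in> S. u 0 = 2}"
      by (rule bij_betw_same_card)
    moreover have "{u \<in> S. u 0 \<noteq> 0} = {u \<in> S. u 0 = 1} \<union> {u \<in> S. u 0 = 2}"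
      using F3_exhaust by auto
    moreover have "{u \<in> S. u 0 = 1} \<inter> {u \<in> S. u 0 = 2} = {}" by auto
    ultimately show ?thesis
      using \<open>finite S\<close> by (simp add: N_def card_Un_disjoint)
  qed
  ultimately show ?thesis by (simp add: weight_count_def S_def)
qed

section \<open>Divisibility by 8 of all weight counts\<close>

theorem theorem3p2:
  fixes m :: nat and C :: "(nat \<Rightarrow> 3) set"
  assumes "m > 0"
    and "near_extremal (12 * m) C"
  shows "\<forall>i\<in>{m..4*m}. weight_count (12 * m) C (3 * i) mod 8 = 0"
proof
  fix i assume "i \<in> {m..4*m}"
  then have i: "i > 0" using assms(1) by simp
  define n where "n = 12 * m"
  define h where "h = wpoly n C (\<lambda>_. 1)"
  \<comment> \<open>Dividing by 8 turns the desired congruence into integrality of an invariant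
    polynomial, which needs checking only up to index m.\<close>
  define p where "p = smult (1 / 8) (h - gleason m 0)"
  have C: "self_dual n C" using assms(2) by (simp add: near_extremal_def n_def)
  have weight_0: "weight n (\<lambda>_. 0) = 0" by (simp add: weight_def)
  have light: "u = (\<lambda>_. 0)" if "u \<in> C" "weight n u = 3 * j" "j < m" for u j
    using near_extremal_min_weight[OF assms(2) that(1)] that by (force simp: n_def)
  have h: "coeff h j = of_nat (weight_count n C (3 * j))" for j
    by (simp add: h_def coeff_wpoly[OF C] weight_count_def)
  \<comment> \<open>The enumerator starts with 1 for the zero word, then has a gap up to index m,
    where the count is already known to be a multiple of 8.\<close>
  have "(coeff h j - coeff 1 j) / 8 \<in> \<int>" if le: "j \<le> m" for j
  proof -
    consider "j = 0" | "0 < j" "j < m" | "j = m" using le by linarith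
    then show ?thesis
    proof cases
      case 1
      have "{u \<in> C. weight n u = 0} = {\<lambda>_. 0}"
        using light[of _ 0] assms(1) C weight_0 by (auto simp: self_dual_def ternary_code_def)
      then show ?thesis using 1 by (simp add: h weight_count_def)
    next
      case 2
      have none: "{u \<in> C. weight n u = 3 * j} = {}"
        using light[of _ j] weight_0 2 by force
      show ?thesis unfolding h weight_count_def none using 2 by (simp add: coeff_1)
    next
      case 3
      then obtain c where "weight_count n C (3 * j) = 8 * c"
        using min_weight_count_mod_8[OF assms] by (auto simp: n_def)
      then show ?thesis using 3 assms(1) by (simp add: h coeff_1)
    qed
  qed
  then have "coeff p j \<in> \<int>" if "j \<le> m" for j
    using Ints_diff[OF _ coeff_gleason_0_mod_8[of m j], of "(coeff h j - coeff 1 j) / 8"] that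
    by (simp add: p_def diff_divide_distrib)
  moreover have "invariant m p"
    unfolding p_def h_def n_def
    using assms(2) by (intro invariant_smult invariant_diff invariant_weight_enumerator invariant_gleason)
      (auto simp: near_extremal_def)
  ultimately have "coeff p i \<in> \<int>" by (rule invariant_coeff_Ints[rotated])
  \<comment> \<open>Adding the correction replaces \<open>gleason m 0\<close> by 1, whose
    coefficient at the positive index \<open>i\<close> is 0.\<close>
  then have "coeff p i + (coeff (gleason m 0) i - coeff 1 i) / 8 \<in> \<int>"
    by (rule Ints_add[OF _ coeff_gleason_0_mod_8])
  also have "coeff p i + (coeff (gleason m 0) i - coeff 1 i) / 8 = of_nat (weight_count n C (3 * i)) / 8"
    using i by (simp add: p_def h diff_divide_distrib coeff_1)
  finally have "of_nat (weight_count n C (3 * i)) / (8 :: complex) \<in> \<int>" .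
  then obtain z where "of_nat (weight_count n C (3 * i)) / (8 :: complex) = of_int z"
    by (auto elim: Ints_cases)
  then have "of_int (int (weight_count n C (3 * i))) = (of_int (8 * z) :: complex)"
    by (simp add: field_simps)
  then have "int (weight_count n C (3 * i)) = 8 * z"
    by (simp only: of_int_eq_iff)
  then show "weight_count (12 * m) C (3 * i) mod 8 = 0"
    unfolding n_def by presburger
qed

end
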